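(* Let $(X^{(n)})_{n}$ be a sequence of Markov chains on state spaces $\mathcal X=\mathcal X^{(n)}$ of size $n$, as described in the context, and suppose there exist a real number $c>2$ and a diverging sequence of positive integers $T=T(n)$ such that, as $n\to\infty$, (HP1) $\max_{x,y\in\mathcal X}|\mu_T^x(y)-\pi(y)|=o(n^{-c})$; (HP2) $T\max_{x\in\mathcal X}\pi(x)=o(1)$; (HP3) $\min_{x\in\mathcal X}\pi(x)=\omega(n^{-2})$. Then for all $x\in\mathcal X$ (i.e. for every choice of $x=x^{(n)}\in\mathcal X^{(n)}$), as $n\to\infty$, $$\sup_{t\ge 0}\left|\frac{\mathbb P_\pi(\tau_x>t)}{\lambda_x^t}-1\right|\longrightarrow 0$$ and $$\left|\frac{\lambda_x}{1-\frac{\pi(x)}{R_T(x)}}-1\right|\longrightarrow 0 .$$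
   Context: For each $n$, $\mathcal X=\mathcal X^{(n)}$ is a finite set with $n$ elements and $(X_t)_{t\ge 0}$ is a discrete-time Markov chain on $\mathcal X$ with ergodic transition matrix $P=P^{(n)}$ and stationary distribution $\pi=\pi^{(n)}$. The dependence on $n$ is suppressed, and all asymptotics are for $n\to\infty$. $\mathbb P_\alpha$ is the law of the chain with initial distribution $\alpha$, and $\mathbb P_y=\mathbb P_{\delta_y}$. We write $\mu_t^x(y)=P^t(x,y)$. For $x\in\mathcal X$, $\tau_x=\inf\{t\ge 0: X_t=x\}$, and $t$ ranges over nonnegative integers. $[P]_x$ is the sub-Markovian kernel on $\mathcal X\setminus\{x\}$ obtained by deleting the $x$-th row and column of $P$; it is assumed irreducible for every $x$. $\lambda_x$ is the leading (Perron–Frobenius) eigenvalue of $[P]_x$. The expected number of returns is $R_T(x)=\sum_{t=0}^{T}\mu_t^x(x)\ge 1$. *)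

theory Defs
  imports "HOL-Probability.Probability" "HOL-Library.Landau_Symbols" "HOL-Library.Extended_Nat"
begin

text \<open>
  A kernel on a finite state space \<open>S\<close> is a function \<open>K :: 'a \<Rightarrow> 'a \<Rightarrow> real\<close> of which only
  the values on \<open>S \<times> S\<close> matter; the carrier \<open>S\<close> is passed explicitly.  Hence the kernel
  \<open>[K]\<^sub>x\<close>, in which the \<open>x\<close>-th row and column are deleted, is \<open>K\<close> with carrier \<open>S - {x}\<close>.
\<close>

primrec kernel_power :: "'a set \<Rightarrow> ('a \<Rightarrow> 'a \<Rightarrow> real) \<Rightarrow> nat \<Rightarrow> 'a \<Rightarrow> 'a \<Rightarrow> real" where
  "kernel_power S K 0 x y = (if x = y then 1 else 0)"
| "kernel_power S K (Suc t) x y = (\<Sum>z\<in>S. kernel_power S K t x z * K z y)"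

definition stochastic_kernel :: "'a set \<Rightarrow> ('a \<Rightarrow> 'a \<Rightarrow> real) \<Rightarrow> bool" where
  "stochastic_kernel S K \<longleftrightarrow>
     (\<forall>x\<in>S. \<forall>y\<in>S. 0 \<le> K x y) \<and> (\<forall>x\<in>S. (\<Sum>y\<in>S. K x y) = 1)"

definition irreducible_kernel :: "'a set \<Rightarrow> ('a \<Rightarrow> 'a \<Rightarrow> real) \<Rightarrow> bool" where
  "irreducible_kernel S K \<longleftrightarrow> (\<forall>x\<in>S. \<forall>y\<in>S. \<exists>t. 0 < kernel_power S K t x y)"

definition aperiodic_kernel :: "'a set \<Rightarrow> ('a \<Rightarrow> 'a \<Rightarrow> real) \<Rightarrow> bool" where
  "aperiodic_kernel S K \<longleftrightarrow> (\<forall>x\<in>S. Gcd {t. 1 \<le> t \<and> 0 < kernel_power S K t x x} = 1)"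

definition ergodic_kernel :: "'a set \<Rightarrow> ('a \<Rightarrow> 'a \<Rightarrow> real) \<Rightarrow> bool" where
  "ergodic_kernel S K \<longleftrightarrow>
     stochastic_kernel S K \<and> irreducible_kernel S K \<and> aperiodic_kernel S K"

definition stationary_distribution :: "'a set \<Rightarrow> ('a \<Rightarrow> 'a \<Rightarrow> real) \<Rightarrow> ('a \<Rightarrow> real) \<Rightarrow> bool" where
  "stationary_distribution S K p \<longleftrightarrow>
     (\<forall>x\<in>S. 0 \<le> p x) \<and> (\<Sum>x\<in>S. p x) = 1 \<and> (\<forall>y\<in>S. (\<Sum>x\<in>S. p x * K x y) = p y)"

definition kernel_eigenvalue :: "'a set \<Rightarrow> ('a \<Rightarrow> 'a \<Rightarrow> real) \<Rightarrow> complex \<Rightarrow> bool" where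
  "kernel_eigenvalue S K \<mu> \<longleftrightarrow>
     (\<exists>v. (\<exists>y\<in>S. v y \<noteq> 0) \<and> (\<forall>y\<in>S. (\<Sum>z\<in>S. of_real (K y z) * v z) = \<mu> * v y))"

text \<open>
  The Perron--Frobenius eigenvalue: the real eigenvalue that dominates the modulus of every
  complex eigenvalue.  There is at most one; for a nonnegative kernel on a finite nonempty
  carrier it exists by the Perron--Frobenius theorem.
\<close>

definition leading_eigenvalue :: "'a set \<Rightarrow> ('a \<Rightarrow> 'a \<Rightarrow> real) \<Rightarrow> real" where
  "leading_eigenvalue S K =
     (THE l. kernel_eigenvalue S K (of_real l) \<and> (\<forall>\<mu>. kernel_eigenvalue S K \<mu> \<longrightarrow> cmod \<mu> \<le> l))"

definition expected_returns :: "'a set \<Rightarrow> ('a \<Rightarrow> 'a \<Rightarrow> real) \<Rightarrow> nat \<Rightarrow> 'a \<Rightarrow> real" where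
  "expected_returns S K T x = (\<Sum>t=0..T. kernel_power S K t x x)"

text \<open>
  \<open>X\<close> is a Markov chain on \<open>S\<close> with initial distribution \<open>a\<close> and transition kernel \<open>K\<close>, realised
  on the probability space \<open>M\<close>.
\<close>

definition markov_chain ::
    "'w measure \<Rightarrow> 'a set \<Rightarrow> ('a \<Rightarrow> real) \<Rightarrow> ('a \<Rightarrow> 'a \<Rightarrow> real) \<Rightarrow> (nat \<Rightarrow> 'w \<Rightarrow> 'a) \<Rightarrow> bool" where
  "markov_chain M S a K X \<longleftrightarrow>
     prob_space M \<and>
     (\<forall>t. X t \<in> measurable M (count_space S)) \<and>
     (\<forall>y\<in>S. \<P>(\<omega> in M. X 0 \<omega> = y) = a y) \<and>
     (\<forall>t z. \<forall>y\<in>S. (\<forall>i\<le>t. z i \<in> S) \<longrightarrow> \<P>(\<omega> in M. \<forall>i\<le>t. X i \<omega> = z i) > 0 \<longrightarrow>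
        \<P>(\<omega> in M. X (Suc t) \<omega> = y \<bar> \<forall>i\<le>t. X i \<omega> = z i) = K (z t) y)"

text \<open>Since \<open>Inf {} = \<infinity>\<close> for extended naturals, the value is \<open>\<infinity>\<close> if \<open>x\<close> is never hit.\<close>

definition hitting_time :: "(nat \<Rightarrow> 'w \<Rightarrow> 'a) \<Rightarrow> 'a \<Rightarrow> 'w \<Rightarrow> enat" where
  "hitting_time X x \<omega> = Inf {enat t | t. X t \<omega> = x}"

end

theory Submission imports Defs begin

text \<open>
  Write \<open>Q\<close> for the kernel with the row and column of \<open>x\<close> deleted, \<open>\<lambda>\<close> for its Perron--Frobenius
  eigenvalue, \<open>\<sigma>\<^sub>t = \<pi> Q\<^sup>t\<close> for the law of the stationary chain on the event that it has not yet hit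
  \<open>x\<close>, and \<open>f(t)\<close> for the total mass of \<open>\<sigma>\<^sub>t\<close>, which is the probability that the hitting time
  exceeds \<open>t\<close>.  By the assumptions on mixing and on \<open>min \<pi>\<close>, every row of \<open>P\<^sup>T\<close> lies between
  \<open>(1 - \<delta>) \<pi>\<close> and \<open>(1 + \<delta>) \<pi>\<close> with \<open>\<delta> \<rightarrow> 0\<close>, and \<open>T \<pi>(x) \<rightarrow> 0\<close>.  What follows is an inequality for
  one chain in terms of \<open>\<delta>\<close> and \<open>\<epsilon> = 2 (1 + \<delta>) T \<pi>(x)\<close>.

  Few survivors are lost in a time window of length \<open>T\<close>: \<open>f(t + T) \<ge> (1 - \<epsilon>) f(t)\<close>
  (\<open>survival_window\<close>).  The measures \<open>\<sigma>\<^sub>t\<close> decrease in \<open>t\<close>, because \<open>\<pi> Q \<le> \<pi>\<close>.  So at most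
  \<open>T P(\<tau>\<^sub>x = t + 1)\<close> is lost between \<open>t\<close> and \<open>t + T\<close>.  Ignoring the killing during the last \<open>T\<close>
  steps before time \<open>t\<close>, the chain is then almost stationary, so that
  \<open>P(\<tau>\<^sub>x = t + 1) \<le> (1 + \<delta>) \<pi>(x) f(t - T)\<close>, and induction on \<open>t\<close> compares \<open>f(t - T)\<close> with \<open>f(t)\<close>.
  Iterating the window estimate bounds the exponential decay rate of \<open>f\<close>, which is \<open>\<lambda>\<close>:
  hence \<open>\<lambda>\<^sup>T \<ge> 1 - \<epsilon>\<close> (\<open>eigenvalue_power_T_ge\<close>).

  Let \<open>g > 0\<close> be the right eigenvector of \<open>Q\<close>, normalised by \<open>\<pi> g = 1\<close>; then \<open>\<sigma>\<^sub>t g = \<lambda>\<^sup>t\<close>.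
  From \<open>\<lambda>\<^sup>T g = Q\<^sup>T g \<le> P\<^sup>T g \<le> 1 + \<delta>\<close> the function \<open>g\<close> is at most \<open>(1 + \<delta>) / (1 - \<epsilon>)\<close>, which gives
  \<open>\<lambda>\<^sup>t \<le> f(t) (1 + \<delta>) / (1 - \<epsilon>)\<close>.  Conversely \<open>\<sigma>\<^sub>t P\<^sup>T g \<ge> (1 - \<delta>) f(t)\<close>, while replacing \<open>P\<^sup>T\<close> by \<open>Q\<^sup>T\<close>
  here removes only mass \<open>f(t) - f(t + T) \<le> \<epsilon> f(t)\<close>, on which \<open>g\<close> is bounded; as
  \<open>\<sigma>\<^sub>t Q\<^sup>T g = \<lambda>\<^sup>t\<^sup>+\<^sup>T \<le> \<lambda>\<^sup>t\<close>, this bounds \<open>f(t) / \<lambda>\<^sup>t\<close> from above.  Both bounds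
  (\<open>survival_compare\<close>) are uniform in \<open>t\<close> and tend to \<open>1\<close>.

  For the second limit, \<open>\<lambda> \<rightarrow> 1\<close> by the above, and \<open>\<pi>(x) / R \<rightarrow> 0\<close> because \<open>R \<ge> 1\<close>.
\<close>

section \<open>The Perron--Frobenius eigenvector of a nonnegative kernel\<close>

lemma kernel_power_add:
  assumes "finite S" "y \<in> S" "z \<in> S"
  shows "kernel_power S K (s + t) y z = (\<Sum>w\<in>S. kernel_power S K s y w * kernel_power S K t w z)"
  using assms(3)
proof (induction t arbitrary: z)
  case 0
  then show ?case using assms(1) by (simp add: sum.delta if_distrib cong: if_cong)
next
  case (Suc t)
  have "kernel_power S K (s + Suc t) y z
      = (\<Sum>u\<in>S. (\<Sum>w\<in>S. kernel_power S K s y w * kernel_power S K t w u) * K u z)"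
    using Suc.IH by simp
  also have "\<dots> = (\<Sum>u\<in>S. \<Sum>w\<in>S. kernel_power S K s y w * (kernel_power S K t w u * K u z))"
    by (simp add: sum_distrib_right mult.assoc)
  also have "\<dots> = (\<Sum>w\<in>S. \<Sum>u\<in>S. kernel_power S K s y w * (kernel_power S K t w u * K u z))"
    by (rule sum.swap)
  finally show ?case by (simp add: sum_distrib_left)
qed

lemma kernel_power_1:
  assumes "finite S" "y \<in> S"
  shows "kernel_power S K (Suc 0) y z = K y z"
  using assms by (simp add: if_distrib[of "\<lambda>u. u * _"] sum.delta' cong: if_cong)

lemma kernel_power_nonneg:
  assumes "\<And>y z. y \<in> S \<Longrightarrow> z \<in> S \<Longrightarrow> 0 \<le> K y z" "y \<in> S" "z \<in> S"
  shows "0 \<le> kernel_power S K t y z"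
  using assms(3) by (induction t arbitrary: z) (auto intro!: sum_nonneg mult_nonneg_nonneg assms)

lemma kernel_power_eigenvector:
  assumes S: "finite S" and eig: "\<And>y. y \<in> S \<Longrightarrow> (\<Sum>z\<in>S. K y z * v z) = l * v y" and y: "y \<in> S"
  shows "(\<Sum>z\<in>S. kernel_power S K t y z * v z) = l ^ t * v y"
proof (induction t)
  case 0
  show ?case using S y by (simp add: if_distrib[of "\<lambda>u. u * _"] sum.delta' cong: if_cong)
next
  case (Suc t)
  have "(\<Sum>z\<in>S. kernel_power S K (Suc t) y z * v z)
      = (\<Sum>z\<in>S. \<Sum>w\<in>S. kernel_power S K t y w * (K w z * v z))"
    by (simp add: sum_distrib_right mult.assoc)
  also have "\<dots> = (\<Sum>w\<in>S. \<Sum>z\<in>S. kernel_power S K t y w * (K w z * v z))"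
    by (rule sum.swap)
  also have "\<dots> = (\<Sum>w\<in>S. kernel_power S K t y w * (\<Sum>z\<in>S. K w z * v z))"
    by (simp add: sum_distrib_left)
  also have "\<dots> = (\<Sum>w\<in>S. l * (kernel_power S K t y w * v w))"
    by (intro sum.cong) (simp_all add: eig)
  also have "\<dots> = l ^ Suc t * v y" by (simp add: sum_distrib_left[symmetric] Suc.IH)
  finally show ?case .
qed

text \<open>
  A largest \<open>l\<close> with \<open>l v \<le> K v\<close> for some distribution \<open>v\<close> exists by compactness: normalised
  vectors form a compact set by Tychonov, and \<open>l\<close> cannot exceed the sum of all entries of \<open>K\<close>.
\<close>

lemma collatz_wielandt_maximizer:
  fixes K :: "'a \<Rightarrow> 'a \<Rightarrow> real"
  assumes S: "finite S" "S \<noteq> {}" and K: "\<And>y z. y \<in> S \<Longrightarrow> z \<in> S \<Longrightarrow> 0 \<le> K y z"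
  shows "\<exists>l v. 0 \<le> l \<and> (\<forall>y\<in>S. 0 \<le> v y) \<and> (\<Sum>y\<in>S. v y) = 1 \<and>
    (\<forall>y\<in>S. l * v y \<le> (\<Sum>z\<in>S. K y z * v z)) \<and>
    (\<forall>l' w. (\<forall>y\<in>S. 0 \<le> w y) \<and> (\<Sum>y\<in>S. w y) > 0 \<and> 0 \<le> l' \<and>
       (\<forall>y\<in>S. l' * w y \<le> (\<Sum>z\<in>S. K y z * w z)) \<longrightarrow> l' \<le> l)"
proof -
  \<comment> \<open>Vectors vanish outside \<open>S\<close>, so that a full product of compact sets contains them.\<close>
  define B :: "('a \<Rightarrow> real) set" where "B = (\<Pi>\<^sub>E i\<in>UNIV. if i \<in> S then {0..1} else {0})"
  define C where "C = (\<Sum>y\<in>S. \<Sum>z\<in>S. K y z)"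
  define F :: "(('a \<Rightarrow> real) \<times> real) set" where
    "F = {q. (\<Sum>y\<in>S. fst q y) = 1} \<inter>
         (\<Inter>y\<in>S. {q. snd q * fst q y \<le> (\<Sum>z\<in>S. K y z * fst q z)})"
  have "compact B"
    unfolding B_def compact_space_def
    using compactin_PiE[of "\<lambda>_. euclidean" "UNIV :: 'a set" "\<lambda>i. if i \<in> S then {0..1} else {0::real}"]
    by (auto simp: euclidean_product_topology)
  have coord: "continuous_on A (\<lambda>q. fst q y)" for A :: "(('a \<Rightarrow> real) \<times> real) set" and y
    by (rule continuous_on_product_then_coordinatewise[OF continuous_on_fst[OF continuous_on_id]])
  have "closed F"
    unfolding F_def
    by (intro closed_Int closed_INT ballI closed_Collect_eq closed_Collect_le continuous_intros coord)
  then have comp: "compact ((B \<times> {0..C}) \<inter> F)"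
    by (intro compact_Int_closed compact_Times \<open>compact B\<close>) auto
  have normalize: "\<exists>u. (u, l') \<in> (B \<times> {0..C}) \<inter> F"
    if w: "\<And>y. y \<in> S \<Longrightarrow> 0 \<le> w y" and pos: "(\<Sum>y\<in>S. w y) > 0" and l': "0 \<le> l'"
      and sub: "\<And>y. y \<in> S \<Longrightarrow> l' * w y \<le> (\<Sum>z\<in>S. K y z * w z)" for l' w
  proof -
    define u where "u y = (if y \<in> S then w y / (\<Sum>y\<in>S. w y) else 0)" for y
    have u0: "0 \<le> u y" for y using w pos by (simp add: u_def)
    have sum1: "(\<Sum>y\<in>S. u y) = 1" using pos by (simp add: u_def sum_divide_distrib[symmetric])
    have le1: "u y \<le> 1" if "y \<in> S" for y
      using member_le_sum[of y S u] that u0 S sum1 by auto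
    have sub': "l' * u y \<le> (\<Sum>z\<in>S. K y z * u z)" if "y \<in> S" for y
    proof -
      have "(\<Sum>z\<in>S. K y z * u z) = (\<Sum>z\<in>S. K y z * w z) / (\<Sum>y\<in>S. w y)"
        by (simp add: u_def sum_divide_distrib)
      then show ?thesis using sub[OF that] pos that by (simp add: u_def divide_right_mono)
    qed
    have "l' = (\<Sum>y\<in>S. l' * u y)" using sum1 by (simp add: sum_distrib_left[symmetric])
    also have "\<dots> \<le> (\<Sum>y\<in>S. \<Sum>z\<in>S. K y z * u z)" by (intro sum_mono sub')
    also have "\<dots> \<le> C" unfolding C_def using K le1 u0
      by (intro sum_mono) (simp add: mult_left_le)
    finally show ?thesis
      using l' u0 le1 sum1 sub' by (intro exI[of _ u]) (simp add: F_def B_def PiE_iff, simp add: u_def)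
  qed
  have "\<exists>u. (u, 0) \<in> (B \<times> {0..C}) \<inter> F"
    using S K by (intro normalize[of "\<lambda>_. 1"]) (auto intro!: sum_nonneg simp: card_gt_0_iff)
  then have "(B \<times> {0..C}) \<inter> F \<noteq> {}" by blast
  from continuous_attains_sup[OF comp this continuous_on_snd[OF continuous_on_id]] obtain q where
    q: "q \<in> (B \<times> {0..C}) \<inter> F" and max: "\<And>r. r \<in> (B \<times> {0..C}) \<inter> F \<Longrightarrow> snd r \<le> snd q"
    by blast
  have "\<forall>y. fst q y \<in> (if y \<in> S then {0..1} else {0})"
    using q by (simp add: B_def PiE_iff mem_Times_iff)
  then have "\<forall>y\<in>S. 0 \<le> fst q y" by (metis atLeastAtMost_iff)
  moreover have "l' \<le> snd q" if "\<forall>y\<in>S. 0 \<le> w y" "(\<Sum>y\<in>S. w y) > 0" "0 \<le> l'"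
      "\<forall>y\<in>S. l' * w y \<le> (\<Sum>z\<in>S. K y z * w z)" for l' w
    using normalize[of w l'] that max by fastforce
  ultimately show ?thesis
    using q by (intro exI[of _ "snd q"] exI[of _ "fst q"]) (auto simp: F_def)
qed

text \<open>
  Collatz--Wielandt argument.  Some sum \<open>B\<close> of powers of \<open>K\<close> has only positive entries and commutes
  with \<open>K\<close>.  If the maximal \<open>l\<close> and its \<open>v\<close> had \<open>K v \<noteq> l v\<close>, then \<open>K (B v) - l (B v) = B (K v - l v)\<close>
  would be positive everywhere, so that \<open>B v\<close> would admit a larger \<open>l\<close>.  Positivity of \<open>v\<close> follows
  since \<open>B v\<close> is positive and a multiple of \<open>v\<close>.
\<close>

lemma perron_frobenius_eigenvector:
  fixes K :: "'a \<Rightarrow> 'a \<Rightarrow> real"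
  assumes S: "finite S" "S \<noteq> {}" and K: "\<And>y z. y \<in> S \<Longrightarrow> z \<in> S \<Longrightarrow> 0 \<le> K y z"
    and irr: "irreducible_kernel S K"
  obtains l v where "0 \<le> l" "\<And>y. y \<in> S \<Longrightarrow> 0 < v y"
    "\<And>y. y \<in> S \<Longrightarrow> (\<Sum>z\<in>S. K y z * v z) = l * v y"
proof -
  from irr obtain t where t: "\<And>y z. y \<in> S \<Longrightarrow> z \<in> S \<Longrightarrow> 0 < kernel_power S K (t y z) y z"
    unfolding irreducible_kernel_def by metis
  define B where "B y z = (\<Sum>(a, b)\<in>S \<times> S. kernel_power S K (t a b) y z)" for y z
  have B_pos: "0 < B y z" if "y \<in> S" "z \<in> S" for y z
    unfolding B_def
    by (rule sum_pos2[of _ "(y, z)"]) (use S that t in \<open>auto intro!: kernel_power_nonneg K\<close>)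
  have B_act: "(\<Sum>z\<in>S. B y z * g z) = (\<Sum>(a, b)\<in>S \<times> S. \<Sum>z\<in>S. kernel_power S K (t a b) y z * g z)" for y g
    unfolding B_def sum_distrib_right split_def by (rule sum.swap)
  have B_comm: "(\<Sum>w\<in>S. K y w * B w z) = (\<Sum>w\<in>S. B y w * K w z)" if "y \<in> S" "z \<in> S" for y z
  proof -
    have "(\<Sum>w\<in>S. K y w * kernel_power S K s w z) = (\<Sum>w\<in>S. kernel_power S K s y w * K w z)" for s
      using kernel_power_add[OF S(1) that, of K "Suc 0" s] kernel_power_1[OF S(1) that(1), of K]
      by simp
    then show ?thesis
      unfolding B_def sum_distrib_left sum_distrib_right split_def
      by (subst sum.swap, subst (2) sum.swap) simp
  qed
  have B_act_pos: "0 < (\<Sum>z\<in>S. B y z * g z)"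
    if "y \<in> S" "\<And>z. z \<in> S \<Longrightarrow> 0 \<le> g z" "a \<in> S" "0 < g a" for y a g
    by (rule sum_pos2[of _ a]) (use S that B_pos in \<open>auto intro!: mult_nonneg_nonneg less_imp_le[OF B_pos]\<close>)
  obtain l v where l: "0 \<le> l" and v: "\<And>y. y \<in> S \<Longrightarrow> 0 \<le> v y" "(\<Sum>y\<in>S. v y) = 1"
    and sub: "\<And>y. y \<in> S \<Longrightarrow> l * v y \<le> (\<Sum>z\<in>S. K y z * v z)"
    and max: "\<forall>l' w. (\<forall>y\<in>S. 0 \<le> w y) \<and> (\<Sum>y\<in>S. w y) > 0 \<and> 0 \<le> l' \<and>
       (\<forall>y\<in>S. l' * w y \<le> (\<Sum>z\<in>S. K y z * w z)) \<longrightarrow> l' \<le> l"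
    using collatz_wielandt_maximizer[of S K, OF S K] by blast
  obtain a where a: "a \<in> S" "0 < v a"
    using v sum_nonpos[of S v] by fastforce
  have eig: "(\<Sum>z\<in>S. K y z * v z) = l * v y" if y: "y \<in> S" for y
  proof (rule ccontr)
    assume neq: "(\<Sum>z\<in>S. K y z * v z) \<noteq> l * v y"
    define u where "u y = (\<Sum>z\<in>S. K y z * v z) - l * v y" for y
    define w where "w y = (\<Sum>z\<in>S. B y z * v z)" for y
    \<comment> \<open>\<open>e\<close> is the amount by which \<open>B v\<close> permits \<open>l\<close> to be increased.\<close>
    define e where "e = Min ((\<lambda>z. (\<Sum>s\<in>S. B z s * u s) / w z) ` S)"
    have u: "0 \<le> u z" if "z \<in> S" for z using sub that by (simp add: u_def)
    have "0 < u y" using neq u[OF y] by (simp add: u_def)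
    have w: "0 < w z" if "z \<in> S" for z
      unfolding w_def using B_act_pos that v a by blast
    have Bu: "0 < (\<Sum>s\<in>S. B z s * u s)" if "z \<in> S" for z
      using B_act_pos that u y \<open>0 < u y\<close> by blast
    have Kw: "(\<Sum>s\<in>S. K z s * w s) = l * w z + (\<Sum>s\<in>S. B z s * u s)" if z: "z \<in> S" for z
    proof -
      have "(\<Sum>s\<in>S. K z s * w s) = (\<Sum>s\<in>S. \<Sum>r\<in>S. K z s * B s r * v r)"
        by (simp add: w_def sum_distrib_left mult.assoc)
      also have "\<dots> = (\<Sum>r\<in>S. (\<Sum>s\<in>S. K z s * B s r) * v r)"
        by (subst sum.swap) (simp add: sum_distrib_right)
      also have "\<dots> = (\<Sum>r\<in>S. (\<Sum>s\<in>S. B z s * K s r) * v r)"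
        using B_comm[OF z] by simp
      also have "\<dots> = (\<Sum>s\<in>S. B z s * (\<Sum>r\<in>S. K s r * v r))"
        unfolding sum_distrib_right sum_distrib_left by (subst sum.swap) (simp add: mult.assoc)
      also have "\<dots> = (\<Sum>s\<in>S. B z s * u s + l * (B z s * v s))"
        by (simp add: u_def algebra_simps)
      finally show ?thesis by (simp add: sum.distrib sum_distrib_left w_def)
    qed
    have e: "0 < e" unfolding e_def using S Bu w by (subst Min_gr_iff) auto
    have "(l + e) * w z \<le> (\<Sum>s\<in>S. K z s * w s)" if "z \<in> S" for z
    proof -
      have "e \<le> (\<Sum>s\<in>S. B z s * u s) / w z" unfolding e_def using S that by (intro Min_le) auto
      then show ?thesis using Kw w that by (simp add: field_simps)
    qed
    moreover have "0 < (\<Sum>z\<in>S. w z)" using S w by (intro sum_pos) auto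
    ultimately have "l + e \<le> l" using max[THEN spec, THEN spec, of w "l + e"] w l e by (simp add: less_imp_le)
    then show False using e by simp
  qed
  have "0 < v y" if y: "y \<in> S" for y
  proof -
    have "0 < (\<Sum>z\<in>S. B y z * v z)" using B_act_pos y v a by blast
    also have "\<dots> = (\<Sum>(a, b)\<in>S \<times> S. l ^ t a b) * v y"
      unfolding B_act
      by (simp add: kernel_power_eigenvector[OF S(1) eig y] split_def sum_distrib_right[symmetric])
    finally show ?thesis using v(1)[OF y] by (cases "v y = 0") auto
  qed
  then show thesis using that l eig by blast
qed

text \<open>
  A positive eigenvector \<open>g\<close> certifies its eigenvalue as the leading one: for any other eigenvector
  \<open>v\<close>, comparing moduli at a maximum of \<open>cmod (v y) / g y\<close> bounds the modulus of its eigenvalue by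
  that of \<open>g\<close>.
\<close>

lemma leading_eigenvalue_eqI:
  fixes K :: "'a \<Rightarrow> 'a \<Rightarrow> real"
  assumes S: "finite S" "S \<noteq> {}" and K: "\<And>y z. y \<in> S \<Longrightarrow> z \<in> S \<Longrightarrow> 0 \<le> K y z"
    and g: "\<And>y. y \<in> S \<Longrightarrow> 0 < g y"
    and eig: "\<And>y. y \<in> S \<Longrightarrow> (\<Sum>z\<in>S. K y z * g z) = l * g y"
  shows "leading_eigenvalue S K = l"
proof -
  have l: "kernel_eigenvalue S K (of_real l)"
    unfolding kernel_eigenvalue_def
  proof (intro exI[of _ "\<lambda>y. of_real (g y)"] conjI ballI)
    show "\<exists>y\<in>S. complex_of_real (g y) \<noteq> 0" using S g by fastforce
    fix y assume "y \<in> S"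
    then show "(\<Sum>z\<in>S. of_real (K y z) * of_real (g z)) = of_real l * complex_of_real (g y)"
      using eig by (simp flip: of_real_mult of_real_sum)
  qed
  have dom: "cmod \<mu> \<le> l" if ev: "kernel_eigenvalue S K \<mu>" for \<mu>
  proof -
    from ev obtain v where v: "\<exists>y\<in>S. v y \<noteq> 0"
      "\<And>y. y \<in> S \<Longrightarrow> (\<Sum>z\<in>S. of_real (K y z) * v z) = \<mu> * v y"
      unfolding kernel_eigenvalue_def by blast
    have "Max ((\<lambda>z. cmod (v z) / g z) ` S) \<in> (\<lambda>z. cmod (v z) / g z) ` S"
      using S by (intro Max_in) auto
    then obtain y where y: "y \<in> S" and y_max: "Max ((\<lambda>z. cmod (v z) / g z) ` S) = cmod (v y) / g y"
      by blast
    have max: "cmod (v z) / g z \<le> cmod (v y) / g y" if "z \<in> S" for z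
      unfolding y_max[symmetric] using S that by (intro Max_ge) auto
    define m where "m = cmod (v y) / g y"
    have bound: "cmod (v z) \<le> m * g z" if "z \<in> S" for z
      using max[OF that] g[OF that] by (simp add: m_def pos_divide_le_eq)
    obtain z where z: "z \<in> S" "v z \<noteq> 0" using v(1) by blast
    then have "0 < m * g z" using bound[of z] less_le_trans[of 0 "cmod (v z)"] by simp
    then have "0 < m" using g[of z] z by (simp add: zero_less_mult_iff)
    have "cmod \<mu> * (m * g y) = cmod (\<mu> * v y)" using g[OF y] by (simp add: m_def norm_mult)
    also have "\<dots> \<le> (\<Sum>z\<in>S. K y z * cmod (v z))"
      unfolding v(2)[OF y, symmetric] using K y
      by (intro order_trans[OF norm_sum] sum_mono) (simp add: norm_mult)
    also have "\<dots> \<le> (\<Sum>z\<in>S. K y z * (m * g z))"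
      using K y bound by (intro sum_mono mult_left_mono) auto
    also have "\<dots> = m * (\<Sum>z\<in>S. K y z * g z)" by (simp add: sum_distrib_left mult_ac)
    also have "\<dots> = l * (m * g y)" using eig[OF y] by simp
    finally show ?thesis using \<open>0 < m\<close> g[OF y] by simp
  qed
  show ?thesis
    unfolding leading_eigenvalue_def
  proof (rule the_equality)
    show "kernel_eigenvalue S K (of_real l) \<and> (\<forall>\<mu>. kernel_eigenvalue S K \<mu> \<longrightarrow> cmod \<mu> \<le> l)"
      using l dom by blast
    fix k assume "kernel_eigenvalue S K (of_real k) \<and> (\<forall>\<mu>. kernel_eigenvalue S K \<mu> \<longrightarrow> cmod \<mu> \<le> k)"
    then show "k = l" using l dom by (metis abs_le_iff norm_of_real order_antisym)
  qed
qed

section \<open>Mass that has not yet been killed\<close>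

text \<open>
  For \<open>y \<in> A\<close> this is the probability to be at \<open>y\<close> at time \<open>t\<close> without having left \<open>A\<close>.  The recursion
  restricts only the earlier positions to \<open>A\<close>; hence for \<open>y \<notin> A\<close> and \<open>t > 0\<close> it is the probability
  that \<open>A\<close> is left at time \<open>t\<close>, through \<open>y\<close>.
\<close>

primrec surviving_mass :: "'a set \<Rightarrow> ('a \<Rightarrow> 'a \<Rightarrow> real) \<Rightarrow> ('a \<Rightarrow> real) \<Rightarrow> nat \<Rightarrow> 'a \<Rightarrow> real" where
  "surviving_mass A K p 0 y = p y"
| "surviving_mass A K p (Suc t) y = (\<Sum>z\<in>A. surviving_mass A K p t z * K z y)"

locale stationary_chain =
  fixes S :: "'a set" and K :: "'a \<Rightarrow> 'a \<Rightarrow> real" and p :: "'a \<Rightarrow> real" and x :: 'a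
  assumes finite_S: "finite S" and stochastic: "stochastic_kernel S K"
    and stationary: "stationary_distribution S K p" and x_in: "x \<in> S"
begin

abbreviation A where "A \<equiv> S - {x}"

abbreviation \<sigma> where "\<sigma> \<equiv> surviving_mass A K p"

definition survival :: "nat \<Rightarrow> real" where "survival t = (\<Sum>y\<in>A. \<sigma> t y)"

lemma K_nonneg: "y \<in> S \<Longrightarrow> z \<in> S \<Longrightarrow> 0 \<le> K y z"
  and K_sum: "y \<in> S \<Longrightarrow> (\<Sum>z\<in>S. K y z) = 1"
  and p_nonneg: "y \<in> S \<Longrightarrow> 0 \<le> p y"
  and p_sum: "(\<Sum>y\<in>S. p y) = 1"
  and p_stationary: "y \<in> S \<Longrightarrow> (\<Sum>z\<in>S. p z * K z y) = p y"
  using stochastic stationary by (auto simp: stochastic_kernel_def stationary_distribution_def)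

lemma kernel_power_stochastic: "y \<in> S \<Longrightarrow> (\<Sum>z\<in>S. kernel_power S K t y z) = 1"
  using kernel_power_eigenvector[OF finite_S, of K "\<lambda>_. 1" 1] K_sum by simp

lemma sum_A: "(\<Sum>y\<in>S. f y) = f x + (\<Sum>y\<in>A. f y :: real)"
  using finite_S x_in by (simp add: sum.remove)

lemma surviving_mass_nonneg: "y \<in> S \<Longrightarrow> 0 \<le> \<sigma> t y"
  by (induction t arbitrary: y) (auto intro!: sum_nonneg mult_nonneg_nonneg K_nonneg p_nonneg)

lemma survival_nonneg: "0 \<le> survival t"
  unfolding survival_def by (intro sum_nonneg surviving_mass_nonneg) auto

text \<open>
  Restricting the stationarity equation to starting points in \<open>A\<close> gives \<open>\<sigma> 1 \<le> p\<close>, and the recursion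
  is monotone.  At \<open>y = x\<close> this says that the law of the hitting time is nonincreasing.
\<close>

lemma surviving_mass_antimono: "s \<le> t \<Longrightarrow> y \<in> S \<Longrightarrow> \<sigma> t y \<le> \<sigma> s y"
proof (rule lift_Suc_antimono_le[of "\<lambda>t. \<sigma> t y"])
  show "\<sigma> (Suc t) y \<le> \<sigma> t y" if "y \<in> S" for t y
    using that
  proof (induction t arbitrary: y)
    case 0
    then show ?case
      using p_stationary[of y] sum_A[of "\<lambda>z. p z * K z y"]
        mult_nonneg_nonneg[OF p_nonneg[OF x_in] K_nonneg[OF x_in, of y]]
      by simp
  next
    case (Suc t)
    then show ?case
      by (subst (1 2) surviving_mass.simps(2)) (intro sum_mono mult_right_mono K_nonneg, auto)
  qed
qed auto

lemma survival_Suc: "survival (Suc t) = survival t - \<sigma> (Suc t) x"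
proof -
  have "\<sigma> (Suc t) x + survival (Suc t) = (\<Sum>y\<in>S. \<Sum>z\<in>A. \<sigma> t z * K z y)"
    unfolding survival_def by (subst sum_A) simp
  also have "\<dots> = (\<Sum>z\<in>A. \<sigma> t z * (\<Sum>y\<in>S. K z y))"
    by (subst sum.swap) (simp add: sum_distrib_left)
  also have "\<dots> = survival t" unfolding survival_def by (simp add: K_sum)
  finally show ?thesis by simp
qed

lemma survival_0: "survival 0 = 1 - p x"
  unfolding survival_def using p_sum sum_A[of p] by simp

lemma survival_drop: "survival t - survival (t + m) \<le> real m * \<sigma> (Suc t) x"
proof (induction m)
  case (Suc m)
  have "\<sigma> (Suc (t + m)) x \<le> \<sigma> (Suc t) x" using x_in by (intro surviving_mass_antimono) auto
  then show ?case using Suc.IH by (simp add: survival_Suc algebra_simps)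
qed simp

text \<open>
  Survivors at time \<open>t + m\<close> are among the chains that survived up to \<open>t\<close> and then moved freely.
\<close>

lemma surviving_mass_le_restart:
  assumes "z \<in> A"
  shows "\<sigma> (t + m) z \<le> (\<Sum>y\<in>A. \<sigma> t y * kernel_power S K m y z)"
  using assms
proof (induction m arbitrary: z)
  case 0
  then show ?case
    using finite_S by (simp add: if_distrib[of "\<lambda>u. _ * u"] sum.delta cong: if_cong)
next
  case (Suc m)
  have "\<sigma> (t + Suc m) z \<le> (\<Sum>w\<in>A. (\<Sum>y\<in>A. \<sigma> t y * kernel_power S K m y w) * K w z)"
    using Suc by (auto intro!: sum_mono mult_right_mono K_nonneg)
  also have "\<dots> \<le> (\<Sum>w\<in>S. (\<Sum>y\<in>A. \<sigma> t y * kernel_power S K m y w) * K w z)"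
    using Suc.prems finite_S
    by (intro sum_mono2 mult_nonneg_nonneg sum_nonneg surviving_mass_nonneg kernel_power_nonneg K_nonneg) auto
  also have "\<dots> = (\<Sum>y\<in>A. \<sigma> t y * kernel_power S K (Suc m) y z)"
    by (simp add: sum_distrib_left sum_distrib_right mult.assoc) (rule sum.swap)
  finally show ?case .
qed

lemma surviving_mass_eigenvector:
  assumes "\<And>y. y \<in> A \<Longrightarrow> (\<Sum>z\<in>A. K y z * g z) = l * g y"
  shows "(\<Sum>y\<in>A. \<sigma> t y * g y) = l ^ t * (\<Sum>y\<in>A. p y * g y)"
proof (induction t)
  case (Suc t)
  have "(\<Sum>y\<in>A. \<sigma> (Suc t) y * g y) = (\<Sum>z\<in>A. \<sigma> t z * (\<Sum>y\<in>A. K z y * g y))"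
    by (simp add: sum_distrib_left sum_distrib_right mult.assoc) (rule sum.swap)
  also have "\<dots> = (\<Sum>y\<in>A. l * (\<sigma> t y * g y))"
    by (intro sum.cong) (simp_all add: assms)
  finally show ?case using Suc.IH by (simp add: sum_distrib_left[symmetric])
qed simp

text \<open>
  Extended by \<open>0\<close> at \<open>x\<close>, an eigenvector of the killed kernel is a subinvariant vector of the full one.
\<close>

lemma eigenvector_le_kernel_power:
  assumes l: "0 \<le> l" and g: "\<And>y. y \<in> A \<Longrightarrow> 0 \<le> g y" "g x = 0"
    and eig: "\<And>y. y \<in> A \<Longrightarrow> (\<Sum>z\<in>A. K y z * g z) = l * g y" and y: "y \<in> A"
  shows "l ^ t * g y \<le> (\<Sum>z\<in>S. kernel_power S K t y z * g z)"
proof (induction t)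
  case 0
  show ?case using finite_S y by (simp add: if_distrib[of "\<lambda>u. u * _"] cong: if_cong)
next
  case (Suc t)
  have g0: "0 \<le> g w" if "w \<in> S" for w using g that by (cases "w = x") auto
  have sub: "l * g w \<le> (\<Sum>z\<in>S. K w z * g z)" if "w \<in> S" for w
  proof (cases "w = x")
    case True
    then show ?thesis using g0 K_nonneg that g(2) by (auto intro!: sum_nonneg)
  next
    case False
    then show ?thesis using eig[of w] that g(2) by (simp add: sum_A)
  qed
  have "l ^ Suc t * g y \<le> (\<Sum>w\<in>S. kernel_power S K t y w * (l * g w))"
    using mult_left_mono[OF Suc.IH l] by (simp add: sum_distrib_left mult_ac)
  also have "\<dots> \<le> (\<Sum>w\<in>S. kernel_power S K t y w * (\<Sum>z\<in>S. K w z * g z))"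
    using y by (intro sum_mono mult_left_mono sub kernel_power_nonneg K_nonneg) auto
  also have "\<dots> = (\<Sum>z\<in>S. kernel_power S K (Suc t) y z * g z)"
    by (simp add: sum_distrib_left sum_distrib_right mult.assoc) (rule sum.swap)
  finally show ?case .
qed

end

section \<open>Comparison of survival with the leading eigenvalue\<close>

text \<open>
  The kernel is within relative error \<open>d\<close> of equilibrium after \<open>T\<close> steps, and \<open>x\<close> is rarely visited
  within \<open>T\<close> steps.  The factor \<open>4\<close> makes \<open>loss\<close> below at most \<open>1 / 2\<close>, which absorbs the constant
  in \<open>survival_window\<close>.
\<close>

locale mixing_chain = stationary_chain +
  fixes T :: nat and d :: real
  assumes T_pos: "0 < T" and d_nonneg: "0 \<le> d"
    and mixing: "\<And>y z. y \<in> S \<Longrightarrow> z \<in> S \<Longrightarrow> \<bar>kernel_power S K T y z - p z\<bar> \<le> d * p z"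
    and short: "4 * ((1 + d) * (real T * p x)) \<le> 1"
begin

text \<open>
  An upper bound for the proportion of survivors that is lost in a time window of length \<open>T\<close>.
\<close>

definition loss where "loss = 2 * ((1 + d) * (real T * p x))"

lemma loss_bounds: "0 \<le> loss" "loss \<le> 1 / 2"
  using d_nonneg p_nonneg[OF x_in] short by (auto simp: loss_def)

lemma T_p_le: "real T * p x \<le> loss / 2"
  using mult_right_mono[of 1 "1 + d" "real T * p x"] d_nonneg p_nonneg[OF x_in] by (simp add: loss_def)

lemma p_x_le: "p x \<le> loss / 2"
  using mult_right_mono[of 1 "real T" "p x"] T_p_le T_pos p_nonneg[OF x_in] by simp

lemma kernel_power_T_le: "y \<in> S \<Longrightarrow> z \<in> S \<Longrightarrow> kernel_power S K T y z \<le> (1 + d) * p z"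
  and kernel_power_T_ge: "y \<in> S \<Longrightarrow> z \<in> S \<Longrightarrow> (1 - d) * p z \<le> kernel_power S K T y z"
  using mixing[of y z] by (auto simp: algebra_simps abs_le_iff)

text \<open>
  Forget the killing during the last \<open>T\<close> steps before the hit: the survivors at time \<open>t\<close> then spread to
  at most \<open>(1 + d) p\<close>, from which \<open>x\<close> is entered with probability at most \<open>(1 + d) * p x\<close>.
\<close>

lemma hit_le_earlier_survival: "\<sigma> (Suc (t + T)) x \<le> (1 + d) * p x * survival t"
proof -
  have "\<sigma> (Suc (t + T)) x \<le> (\<Sum>z\<in>A. ((1 + d) * p z * survival t) * K z x)"
    unfolding surviving_mass.simps
  proof (intro sum_mono mult_right_mono K_nonneg)
    fix z assume z: "z \<in> A"
    have "\<sigma> (t + T) z \<le> (\<Sum>y\<in>A. \<sigma> t y * ((1 + d) * p z))"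
      using z by (intro order_trans[OF surviving_mass_le_restart] sum_mono mult_left_mono
          kernel_power_T_le surviving_mass_nonneg) auto
    then show "\<sigma> (t + T) z \<le> (1 + d) * p z * survival t"
      by (simp add: survival_def sum_distrib_left sum_distrib_right mult_ac)
  qed (use x_in in auto)
  also have "\<dots> = (1 + d) * survival t * (\<Sum>z\<in>A. p z * K z x)"
    by (simp add: sum_distrib_left mult_ac)
  also have "\<dots> \<le> (1 + d) * survival t * p x"
    using surviving_mass_antimono[of 0 1 x] x_in d_nonneg survival_nonneg
    by (intro mult_left_mono) auto
  finally show ?thesis by (simp add: mult_ac)
qed

text \<open>
  For \<open>t \<ge> T\<close> the loss after \<open>t\<close> is at most \<open>(loss / 2) * survival (t - T)\<close>, and the induction hypothesis
  at \<open>t - T\<close> gives \<open>survival (t - T) \<le> 2 * survival t\<close>.  For \<open>t < T\<close> almost all of the mass is still alive.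
\<close>

lemma survival_window: "(1 - loss) * survival t \<le> survival (t + T)"
proof (induction t rule: less_induct)
  case (less t)
  show ?case
  proof (cases "t < T")
    case True
    have drop: "survival s - survival (s + m) \<le> loss / 2" if "m \<le> T" for s m
    proof -
      have "survival s - survival (s + m) \<le> real m * \<sigma> (Suc s) x" by (rule survival_drop)
      also have "\<dots> \<le> real T * p x"
        using that surviving_mass_antimono[of 0 "Suc s" x] x_in surviving_mass_nonneg[of x "Suc s"]
        by (intro mult_mono) auto
      finally show ?thesis using T_p_le by simp
    qed
    have "1 - loss \<le> survival t"
      using drop[of t 0] True survival_0 p_x_le by simp
    moreover have "loss * (1 - loss) \<ge> loss / 2" using loss_bounds mult_left_mono[of "1/2" "1 - loss" loss] by simp
    ultimately have "loss / 2 \<le> loss * survival t"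
      using loss_bounds mult_left_mono[of "1 - loss" "survival t" loss] by linarith
    then show ?thesis using drop[of T t] by (simp add: algebra_simps)
  next
    case False
    define s where "s = t - T"
    have t: "t = s + T" using False by (simp add: s_def)
    have IH: "(1 - loss) * survival s \<le> survival t" unfolding t by (rule less.IH) (simp add: t T_pos)
    have "survival s \<le> 2 * survival t"
      using IH loss_bounds mult_right_mono[of "1/2" "1 - loss" "survival s"] survival_nonneg[of s] by simp
    then have "loss / 2 * survival s \<le> loss * survival t"
      using loss_bounds mult_left_mono[of "survival s" "2 * survival t" "loss / 2"] by simp
    moreover have "survival t - survival (t + T) \<le> loss / 2 * survival s"
    proof -
      have "survival t - survival (t + T) \<le> real T * \<sigma> (Suc t) x" by (rule survival_drop)
      also have "\<dots> \<le> real T * ((1 + d) * p x * survival s)"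
        unfolding t by (intro mult_left_mono hit_le_earlier_survival) auto
      finally show ?thesis by (simp add: loss_def algebra_simps)
    qed
    ultimately show ?thesis by (simp add: algebra_simps)
  qed
qed

lemma survival_geometric: "(1 - loss) ^ k * survival 0 \<le> survival (k * T)"
proof (induction k)
  case (Suc k)
  have "(1 - loss) * ((1 - loss) ^ k * survival 0) \<le> (1 - loss) * survival (k * T)"
    using Suc.IH loss_bounds by (intro mult_left_mono) auto
  also have "\<dots> \<le> survival (k * T + T)" by (rule survival_window)
  finally show ?case by (simp add: add.commute mult_ac)
qed simp

lemma A_nonempty: "A \<noteq> {}"
proof
  assume "A = {}"
  then have "survival 0 = 0" unfolding survival_def by (simp only: sum.empty)
  then show False using survival_0 p_x_le loss_bounds by simp
qed

context
  fixes l :: real and g :: "'a \<Rightarrow> real"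
  assumes l_nonneg: "0 \<le> l" and g_pos: "\<And>y. y \<in> A \<Longrightarrow> 0 < g y"
    and eig: "\<And>y. y \<in> A \<Longrightarrow> (\<Sum>z\<in>A. K y z * g z) = l * g y"
begin

lemma surviving_mass_pairing: "(\<Sum>y\<in>A. \<sigma> t y * g y) = l ^ t * (\<Sum>y\<in>A. p y * g y)"
  by (rule surviving_mass_eigenvector) (rule eig)

lemma eigenvalue_le_1: "l \<le> 1"
proof -
  have "Max (g ` A) \<in> g ` A" using finite_S A_nonempty by (intro Max_in) auto
  then obtain y where y: "y \<in> A" "Max (g ` A) = g y" by blast
  have max: "g z \<le> g y" if "z \<in> A" for z
    unfolding y(2)[symmetric] using finite_S that by (intro Max_ge) auto
  have "l * g y \<le> (\<Sum>z\<in>A. K y z * g y)"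
    unfolding eig[OF y(1), symmetric] using max y by (intro sum_mono mult_left_mono K_nonneg) auto
  also have "\<dots> \<le> (\<Sum>z\<in>S. K y z) * g y"
    using y g_pos[of y] K_nonneg[of y] x_in by (simp add: sum_A sum_distrib_right[symmetric])
  finally show ?thesis using K_sum[of y] y g_pos[of y] by simp
qed

text \<open>
  Survival decays at most like \<open>(1 - loss)\<^sup>k\<close> along multiples \<open>k * T\<close>, and since \<open>g\<close> is bounded away from
  \<open>0\<close> also at least like \<open>(l ^ T)\<^sup>k\<close>; a smaller \<open>l ^ T\<close> would contradict this as \<open>k\<close> grows.
\<close>

lemma eigenvalue_power_T_ge: "1 - loss \<le> l ^ T"
proof (rule ccontr)
  assume "\<not> ?thesis"
  then have lt: "l ^ T / (1 - loss) < 1" using loss_bounds by simp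
  define m where "m = Min (g ` A)"
  have m: "0 < m" unfolding m_def using finite_S A_nonempty g_pos by (subst Min_gr_iff) auto
  define c where "c = (\<Sum>y\<in>A. p y * g y)"
  have bound: "m * survival 0 \<le> c * (l ^ T / (1 - loss)) ^ k" for k
  proof -
    have "m * ((1 - loss) ^ k * survival 0) \<le> m * survival (k * T)"
      using m survival_geometric by (intro mult_left_mono) auto
    also have "\<dots> \<le> (\<Sum>y\<in>A. \<sigma> (k * T) y * g y)"
      unfolding survival_def sum_distrib_left m_def
      using finite_S
      by (intro sum_mono, subst mult.commute) (intro mult_left_mono surviving_mass_nonneg Min_le; simp)
    also have "\<dots> = c * (l ^ T) ^ k"
      unfolding surviving_mass_pairing c_def by (simp add: power_mult[symmetric] mult.commute)
    finally show ?thesis using loss_bounds by (simp add: power_divide field_simps)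
  qed
  have "(\<lambda>k. c * (l ^ T / (1 - loss)) ^ k) \<longlonglongrightarrow> c * 0"
    using lt l_nonneg loss_bounds by (intro tendsto_intros LIMSEQ_realpow_zero) auto
  then have "m * survival 0 \<le> c * 0" by (rule LIMSEQ_le_const) (use bound in auto)
  moreover have "0 < survival 0" using survival_0 p_x_le loss_bounds by simp
  ultimately show False using mult_pos_pos[OF m, of "survival 0"] by simp
qed

lemma eigenvalue_ge: "1 - loss \<le> l"
proof -
  have "l ^ T \<le> l ^ 1" using l_nonneg eigenvalue_le_1 T_pos by (intro power_decreasing) auto
  then show ?thesis using eigenvalue_power_T_ge by simp
qed

text \<open>
  Both bounds come from evaluating \<open>l ^ t * (\<Sum>y\<in>A. p y * g y)\<close> as a pairing of the surviving mass
  with \<open>g\<close>.  Since \<open>g\<close> is at most \<open>(1 + d) / (1 - loss)\<close> times its \<open>p\<close>-mean, few survivors cannot have a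
  large pairing.  Conversely, after \<open>T\<close> further free steps the survivors pair with \<open>g\<close> as \<open>p\<close> does, up to
  \<open>1 - d\<close>, and little of that pairing is lost to killing.
\<close>

lemma survival_compare:
  shows "l ^ t * (1 - loss) \<le> (1 + d) * survival t"
    and "(1 - d - loss * (1 + d) / (1 - loss)) * survival t \<le> l ^ t"
proof -
  define c where "c = (\<Sum>y\<in>A. p y * g y)"
  define G where "G = (1 + d) / (1 - loss)"
  define h where "h y = (if y = x then 0 else g y)" for y
  have h: "(\<Sum>z\<in>A. f z * h z) = (\<Sum>z\<in>A. f z * g z)" for f
    by (intro sum.cong) (auto simp: h_def)
  have h_eig: "(\<Sum>z\<in>A. K y z * h z) = l * h y" if "y \<in> A" for y
    unfolding h using that eig by (auto simp: h_def)
  have c0: "0 \<le> c" unfolding c_def using p_nonneg g_pos by (intro sum_nonneg mult_nonneg_nonneg) (auto intro: less_imp_le)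
  have flat: "g y \<le> G * c" if y: "y \<in> A" for y
  proof -
    have "(1 - loss) * g y \<le> l ^ T * g y"
      using eigenvalue_power_T_ge g_pos[OF y] by (intro mult_right_mono) auto
    also have "\<dots> = l ^ T * h y" using y by (simp add: h_def)
    also have "\<dots> \<le> (\<Sum>z\<in>S. kernel_power S K T y z * h z)"
      using y g_pos h_eig l_nonneg
      by (intro eigenvector_le_kernel_power) (auto simp: h_def less_imp_le)
    also have "\<dots> \<le> (\<Sum>z\<in>S. (1 + d) * p z * h z)"
      using y g_pos by (intro sum_mono mult_right_mono kernel_power_T_le) (auto simp: h_def less_imp_le)
    also have "\<dots> = (1 + d) * c"
      by (simp add: sum_A h c_def sum_distrib_left mult.assoc) (simp add: h_def)
    finally show ?thesis using loss_bounds by (simp add: G_def field_simps)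
  qed
  obtain y0 where "y0 \<in> A" using A_nonempty by blast
  then have "0 < G * c" using flat[of y0] g_pos[of y0] by simp
  then have c: "0 < c" using c0 by (cases "c = 0") auto
  have upper: "l ^ t * c \<le> G * c * survival t"
  proof -
    have "l ^ t * c = (\<Sum>y\<in>A. \<sigma> t y * g y)" unfolding c_def by (simp add: surviving_mass_pairing)
    also have "\<dots> \<le> (\<Sum>y\<in>A. \<sigma> t y * (G * c))"
      using flat by (intro sum_mono mult_left_mono surviving_mass_nonneg) auto
    finally show ?thesis by (simp add: survival_def sum_distrib_left mult_ac)
  qed
  then have "l ^ t \<le> G * survival t" using c by (simp add: mult.commute mult.left_commute)
  then show "l ^ t * (1 - loss) \<le> (1 + d) * survival t"
    using loss_bounds by (simp add: G_def field_simps)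
  \<comment> \<open>\<open>q\<close> is the surviving mass at time \<open>t\<close> transported by \<open>T\<close> free steps; its excess over
    the surviving mass at time \<open>t + T\<close> is paid for by \<open>survival t - survival (t + T)\<close>.\<close>
  define q where "q z = (\<Sum>y\<in>A. \<sigma> t y * kernel_power S K T y z)" for z
  have q_ge: "\<sigma> (t + T) z \<le> q z" if "z \<in> A" for z
    unfolding q_def using that by (rule surviving_mass_le_restart)
  have q_mix: "survival t * (1 - d) * p z \<le> q z" if "z \<in> A" for z
    unfolding q_def survival_def sum_distrib_right using that
    by (intro sum_mono) (auto intro!: mult_left_mono surviving_mass_nonneg kernel_power_T_ge simp: mult.assoc)
  have q_sum: "(\<Sum>z\<in>A. q z) \<le> survival t"
  proof -
    have "(\<Sum>z\<in>A. q z) \<le> (\<Sum>z\<in>S. q z)"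
      using finite_S x_in unfolding q_def
      by (intro sum_mono2 sum_nonneg mult_nonneg_nonneg surviving_mass_nonneg kernel_power_nonneg K_nonneg) auto
    also have "\<dots> = (\<Sum>y\<in>A. \<sigma> t y * (\<Sum>z\<in>S. kernel_power S K T y z))"
      unfolding q_def sum_distrib_left by (rule sum.swap)
    also have "\<dots> = survival t" unfolding survival_def by (simp add: kernel_power_stochastic)
    finally show ?thesis .
  qed
  have "survival t * (1 - d) * c - G * c * (survival t - survival (t + T)) \<le> l ^ (t + T) * c"
  proof -
    have "survival t * (1 - d) * c \<le> (\<Sum>z\<in>A. q z * g z)"
      unfolding c_def sum_distrib_left mult.assoc[symmetric]
      using q_mix g_pos by (intro sum_mono mult_right_mono) (auto intro: less_imp_le)
    moreover have "(\<Sum>z\<in>A. (q z - \<sigma> (t + T) z) * g z) \<le> (\<Sum>z\<in>A. (q z - \<sigma> (t + T) z) * (G * c))"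
      using flat q_ge by (intro sum_mono mult_left_mono) auto
    moreover have "(\<Sum>z\<in>A. (q z - \<sigma> (t + T) z) * (G * c)) \<le> G * c * (survival t - survival (t + T))"
      unfolding sum_distrib_right[symmetric] sum_subtractf
      using q_sum \<open>0 < G * c\<close> by (simp add: survival_def mult.commute mult_left_mono)
    moreover have "(\<Sum>z\<in>A. (q z - \<sigma> (t + T) z) * g z) = (\<Sum>z\<in>A. q z * g z) - l ^ (t + T) * c"
      unfolding c_def surviving_mass_pairing[symmetric]
      by (simp add: left_diff_distrib sum_subtractf)
    ultimately show ?thesis by linarith
  qed
  moreover have "G * c * (survival t - survival (t + T)) \<le> G * c * (loss * survival t)"
    using survival_window[of t] \<open>0 < G * c\<close> by (intro mult_left_mono) (auto simp: algebra_simps)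
  moreover have "l ^ (t + T) * c \<le> l ^ t * c"
    using l_nonneg eigenvalue_le_1 c by (intro mult_right_mono power_decreasing) auto
  ultimately have "((1 - d - loss * G) * survival t) * c \<le> l ^ t * c"
    by (simp add: algebra_simps)
  then show "(1 - d - loss * (1 + d) / (1 - loss)) * survival t \<le> l ^ t"
    using c by (simp add: G_def)
qed

end

lemma leading_eigenvalue_bounds:
  assumes irr: "irreducible_kernel A K"
  shows "1 - loss \<le> leading_eigenvalue A K" "leading_eigenvalue A K \<le> 1"
    and "leading_eigenvalue A K ^ t * (1 - loss) \<le> (1 + d) * survival t"
    and "(1 - d - loss * (1 + d) / (1 - loss)) * survival t \<le> leading_eigenvalue A K ^ t"
proof -
  have A: "finite A" using finite_S by simp
  have K: "0 \<le> K y z" if "y \<in> A" "z \<in> A" for y z using that K_nonneg by simp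
  obtain l g where l: "0 \<le> l" and g: "\<And>y. y \<in> A \<Longrightarrow> 0 < g y"
    and eig: "\<And>y. y \<in> A \<Longrightarrow> (\<Sum>z\<in>A. K y z * g z) = l * g y"
    using perron_frobenius_eigenvector[OF A A_nonempty K irr] by blast
  have "leading_eigenvalue A K = l"
    using leading_eigenvalue_eqI[OF A A_nonempty K g eig] by blast
  then show "1 - loss \<le> leading_eigenvalue A K" "leading_eigenvalue A K \<le> 1"
    "leading_eigenvalue A K ^ t * (1 - loss) \<le> (1 + d) * survival t"
    "(1 - d - loss * (1 + d) / (1 - loss)) * survival t \<le> leading_eigenvalue A K ^ t"
    using eigenvalue_ge[OF l g eig] eigenvalue_le_1[OF l g eig] survival_compare[OF l g eig] by simp_all
qed

lemma survival_ratio_error: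
  assumes irr: "irreducible_kernel A K" and pos: "0 < 1 - d - loss * (1 + d) / (1 - loss)"
  shows "\<bar>survival t / leading_eigenvalue A K ^ t - 1\<bar>
    \<le> (d + loss) + \<bar>1 / (1 - d - loss * (1 + d) / (1 - loss)) - 1\<bar>"
proof -
  define l where "l = leading_eigenvalue A K ^ t"
  define D where "D = 1 - d - loss * (1 + d) / (1 - loss)"
  have "0 < leading_eigenvalue A K" using leading_eigenvalue_bounds(1)[OF irr] loss_bounds by simp
  then have l: "0 < l" by (simp add: l_def)
  have "(1 - loss) / (1 + d) \<le> survival t / l"
    using leading_eigenvalue_bounds(3)[OF irr, of t] l d_nonneg
    by (simp add: l_def[symmetric] field_simps)
  moreover have "1 - (d + loss) \<le> (1 - loss) / (1 + d)"
  proof -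
    have "(1 - (d + loss)) * (1 + d) \<le> 1 - loss"
      using mult_nonneg_nonneg[OF d_nonneg d_nonneg] mult_nonneg_nonneg[OF d_nonneg loss_bounds(1)]
      by (simp add: algebra_simps)
    then show ?thesis using d_nonneg by (simp add: pos_le_divide_eq)
  qed
  moreover have "survival t / l \<le> 1 / D"
  proof -
    have "D * survival t \<le> l"
      unfolding l_def D_def by (rule leading_eigenvalue_bounds(4)[OF irr])
    then show ?thesis using l pos unfolding D_def[symmetric] by (simp add: field_simps)
  qed
  ultimately show ?thesis
    using d_nonneg loss_bounds unfolding l_def[symmetric] D_def[symmetric] by (simp add: abs_le_iff) linarith
qed

end

section \<open>Survival probabilities of a Markov chain\<close>

lemma hitting_time_gt_iff: "enat t < hitting_time X x \<omega> \<longleftrightarrow> (\<forall>i\<le>t. X i \<omega> \<noteq> x)"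
proof
  assume gt: "enat t < hitting_time X x \<omega>"
  show "\<forall>i\<le>t. X i \<omega> \<noteq> x"
  proof (intro allI impI notI)
    fix i assume "i \<le> t" "X i \<omega> = x"
    then have "hitting_time X x \<omega> \<le> enat i" unfolding hitting_time_def by (intro Inf_lower) auto
    also have "\<dots> \<le> enat t" using \<open>i \<le> t\<close> by simp
    finally show False using gt by simp
  qed
next
  assume "\<forall>i\<le>t. X i \<omega> \<noteq> x"
  then have "enat (Suc t) \<le> hitting_time X x \<omega>"
    unfolding hitting_time_def by (intro Inf_greatest) (auto simp: not_le[symmetric] Suc_le_eq)
  then show "enat t < hitting_time X x \<omega>" by (meson enat_ord_simps(2) lessI less_le_trans)
qed

context
  fixes M :: "'w measure" and S :: "'a set" and a :: "'a \<Rightarrow> real" and K and X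
  assumes finite: "finite S" and chain: "markov_chain M S a K X"
begin

interpretation prob_space M using chain by (simp add: markov_chain_def)

lemma chain_in_state_space: "\<omega> \<in> space M \<Longrightarrow> X t \<omega> \<in> S"
  using chain measurable_space[of "X t" M "count_space S" \<omega>] by (simp add: markov_chain_def)

lemma chain_event: "{\<omega>\<in>space M. Q (X t \<omega>)} \<in> events"
proof -
  have "X t -` {s\<in>S. Q s} \<inter> space M \<in> events"
    using chain by (intro measurable_sets[of _ M "count_space S"]) (auto simp: markov_chain_def)
  also have "X t -` {s\<in>S. Q s} \<inter> space M = {\<omega>\<in>space M. Q (X t \<omega>)}"
    using chain_in_state_space by auto
  finally show ?thesis .
qed

lemma chain_event_path: "{\<omega>\<in>space M. \<forall>i\<le>t. Q i (X i \<omega>)} \<in> events"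
  using sets.sets_Collect_finite_All'[of "{..t}" M "\<lambda>i \<omega>. Q i (X i \<omega>)"] chain_event by auto

lemma confined_event: "{\<omega>\<in>space M. (\<forall>i\<le>t. X i \<omega> \<in> B) \<and> X t \<omega> = z} \<in> events"
  by (rule sets.sets_Collect_conj[OF chain_event[of "\<lambda>s. s = z"] chain_event_path[of t "\<lambda>_ s. s \<in> B"]])

text \<open>
  The Markov property is stated only for pasts of positive probability; for null pasts both sides vanish.
\<close>

lemma prob_path_step:
  assumes z: "\<And>i. i \<le> t \<Longrightarrow> z i \<in> S" and y: "y \<in> S"
  shows "\<P>(\<omega> in M. (\<forall>i\<le>t. X i \<omega> = z i) \<and> X (Suc t) \<omega> = y)
    = \<P>(\<omega> in M. \<forall>i\<le>t. X i \<omega> = z i) * K (z t) y"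
proof (cases "\<P>(\<omega> in M. \<forall>i\<le>t. X i \<omega> = z i) > 0")
  case True
  then have "\<P>(\<omega> in M. X (Suc t) \<omega> = y \<bar> \<forall>i\<le>t. X i \<omega> = z i) = K (z t) y"
    using chain z y unfolding markov_chain_def by blast
  then show ?thesis using True by (simp add: cond_prob_def conj_commute field_simps)
next
  case False
  then have zero: "\<P>(\<omega> in M. \<forall>i\<le>t. X i \<omega> = z i) = 0"
    using measure_nonneg[of M] by (simp add: not_less order_antisym)
  have "\<P>(\<omega> in M. (\<forall>i\<le>t. X i \<omega> = z i) \<and> X (Suc t) \<omega> = y) \<le> \<P>(\<omega> in M. \<forall>i\<le>t. X i \<omega> = z i)"
    by (intro finite_measure_mono chain_event_path) auto
  then show ?thesis using zero measure_nonneg[of M] by (simp add: order_antisym)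
qed

text \<open>
  The past event is a finite disjoint union of the paths in \<open>B\<close> that end in \<open>z\<close>; the transition
  probability is the same for all of them.
\<close>

lemma prob_confined_step:
  assumes B: "B \<subseteq> S" and y: "y \<in> S"
  shows "\<P>(\<omega> in M. ((\<forall>i\<le>t. X i \<omega> \<in> B) \<and> X t \<omega> = z) \<and> X (Suc t) \<omega> = y)
    = \<P>(\<omega> in M. (\<forall>i\<le>t. X i \<omega> \<in> B) \<and> X t \<omega> = z) * K z y"
proof -
  define F where "F = {q \<in> {..t} \<rightarrow>\<^sub>E B. q t = z}"
  have F: "finite F" unfolding F_def using finite_subset[OF B finite] by (auto intro!: finite_PiE)
  have path: "(\<forall>q\<in>F. (\<forall>i\<le>t. X i \<omega> = q i) \<longrightarrow> (\<forall>i\<le>t. X i \<omega> \<in> B) \<and> X t \<omega> = z) \<and>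
      ((\<forall>i\<le>t. X i \<omega> \<in> B) \<and> X t \<omega> = z \<longrightarrow> (\<exists>!q. q \<in> F \<and> (\<forall>i\<le>t. X i \<omega> = q i)))" for \<omega>
  proof (intro conjI ballI impI)
    assume conf: "(\<forall>i\<le>t. X i \<omega> \<in> B) \<and> X t \<omega> = z"
    show "\<exists>!q. q \<in> F \<and> (\<forall>i\<le>t. X i \<omega> = q i)"
    proof (rule ex1I[of _ "restrict (\<lambda>i. X i \<omega>) {..t}"])
      show "restrict (\<lambda>i. X i \<omega>) {..t} \<in> F \<and> (\<forall>i\<le>t. X i \<omega> = restrict (\<lambda>i. X i \<omega>) {..t} i)"
        using conf by (auto simp: F_def)
      show "q = restrict (\<lambda>i. X i \<omega>) {..t}" if "q \<in> F \<and> (\<forall>i\<le>t. X i \<omega> = q i)" for q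
        using that by (intro extensionalityI[of _ "{..t}"]) (auto simp: F_def PiE_def)
    qed
  qed (auto simp: F_def PiE_iff)
  note ev = confined_event[of t B z]
  have "\<P>(\<omega> in M. ((\<forall>i\<le>t. X i \<omega> \<in> B) \<and> X t \<omega> = z) \<and> X (Suc t) \<omega> = y)
      = (\<Sum>q\<in>F. \<P>(\<omega> in M. (\<forall>i\<le>t. X i \<omega> = q i) \<and> X (Suc t) \<omega> = y))"
  proof (rule prob_sum[OF F])
    show "{\<omega>\<in>space M. (\<forall>i\<le>t. X i \<omega> = q i) \<and> X (Suc t) \<omega> = y} \<in> events" for q
      by (rule sets.sets_Collect_conj[OF chain_event[of "\<lambda>s. s = y"] chain_event_path[of t "\<lambda>i s. s = q i"]])
    show "{\<omega>\<in>space M. ((\<forall>i\<le>t. X i \<omega> \<in> B) \<and> X t \<omega> = z) \<and> X (Suc t) \<omega> = y} \<in> events"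
      by (rule sets.sets_Collect_conj[OF chain_event[of "\<lambda>s. s = y"] ev])
    show "AE \<omega> in M.
        (\<forall>q\<in>F. (\<forall>i\<le>t. X i \<omega> = q i) \<and> X (Suc t) \<omega> = y \<longrightarrow>
           ((\<forall>i\<le>t. X i \<omega> \<in> B) \<and> X t \<omega> = z) \<and> X (Suc t) \<omega> = y) \<and>
        (((\<forall>i\<le>t. X i \<omega> \<in> B) \<and> X t \<omega> = z) \<and> X (Suc t) \<omega> = y \<longrightarrow>
           (\<exists>!q. q \<in> F \<and> ((\<forall>i\<le>t. X i \<omega> = q i) \<and> X (Suc t) \<omega> = y)))"
    proof (rule AE_I2)
      fix \<omega>
      show "(\<forall>q\<in>F. (\<forall>i\<le>t. X i \<omega> = q i) \<and> X (Suc t) \<omega> = y \<longrightarrow>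
           ((\<forall>i\<le>t. X i \<omega> \<in> B) \<and> X t \<omega> = z) \<and> X (Suc t) \<omega> = y) \<and>
        (((\<forall>i\<le>t. X i \<omega> \<in> B) \<and> X t \<omega> = z) \<and> X (Suc t) \<omega> = y \<longrightarrow>
           (\<exists>!q. q \<in> F \<and> ((\<forall>i\<le>t. X i \<omega> = q i) \<and> X (Suc t) \<omega> = y)))"
        using path[of \<omega>] by (cases "X (Suc t) \<omega> = y") simp_all
    qed
  qed
  also have "\<dots> = (\<Sum>q\<in>F. \<P>(\<omega> in M. \<forall>i\<le>t. X i \<omega> = q i) * K z y)"
  proof (rule sum.cong[OF refl])
    fix q assume "q \<in> F"
    then have "\<And>i. i \<le> t \<Longrightarrow> q i \<in> S" "q t = z" using B by (auto simp: F_def PiE_iff)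
    then show "\<P>(\<omega> in M. (\<forall>i\<le>t. X i \<omega> = q i) \<and> X (Suc t) \<omega> = y)
        = \<P>(\<omega> in M. \<forall>i\<le>t. X i \<omega> = q i) * K z y"
      using prob_path_step[of t q y] y by simp
  qed
  also have "\<dots> = (\<Sum>q\<in>F. \<P>(\<omega> in M. \<forall>i\<le>t. X i \<omega> = q i)) * K z y"
    by (simp only: sum_distrib_right)
  also have "(\<Sum>q\<in>F. \<P>(\<omega> in M. \<forall>i\<le>t. X i \<omega> = q i))
      = \<P>(\<omega> in M. (\<forall>i\<le>t. X i \<omega> \<in> B) \<and> X t \<omega> = z)"
  proof (rule prob_sum[OF F, symmetric])
    show "{\<omega>\<in>space M. \<forall>i\<le>t. X i \<omega> = q i} \<in> events" for q
      by (rule chain_event_path[of t "\<lambda>i s. s = q i"])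
  qed (rule ev, rule AE_I2, rule path)
  finally show ?thesis .
qed

lemma prob_confined_at:
  assumes B: "B \<subseteq> S" and y: "y \<in> B"
  shows "\<P>(\<omega> in M. (\<forall>i\<le>t. X i \<omega> \<in> B) \<and> X t \<omega> = y) = surviving_mass B K a t y"
  using y
proof (induction t arbitrary: y)
  case 0
  have "\<P>(\<omega> in M. (\<forall>i\<le>0. X i \<omega> \<in> B) \<and> X 0 \<omega> = y) = \<P>(\<omega> in M. X 0 \<omega> = y)"
    using 0 by (intro arg_cong[of _ _ "measure M"]) auto
  then show ?case using chain 0 B unfolding markov_chain_def by auto
next
  case (Suc t)
  have "\<P>(\<omega> in M. (\<forall>i\<le>Suc t. X i \<omega> \<in> B) \<and> X (Suc t) \<omega> = y)
      = (\<Sum>z\<in>B. \<P>(\<omega> in M. ((\<forall>i\<le>t. X i \<omega> \<in> B) \<and> X t \<omega> = z) \<and> X (Suc t) \<omega> = y))"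
  proof (rule prob_sum)
    show "finite B" using finite_subset[OF B finite] .
    show "{\<omega>\<in>space M. ((\<forall>i\<le>t. X i \<omega> \<in> B) \<and> X t \<omega> = z) \<and> X (Suc t) \<omega> = y} \<in> events" for z
      by (rule sets.sets_Collect_conj[OF chain_event[of "\<lambda>s. s = y"] confined_event])
    show "{\<omega>\<in>space M. (\<forall>i\<le>Suc t. X i \<omega> \<in> B) \<and> X (Suc t) \<omega> = y} \<in> events"
      by (rule confined_event)
  qed (use Suc.prems in \<open>auto intro!: AE_I2 simp: le_Suc_eq\<close>)
  also have "\<dots> = (\<Sum>z\<in>B. \<P>(\<omega> in M. (\<forall>i\<le>t. X i \<omega> \<in> B) \<and> X t \<omega> = z) * K z y)"
    using Suc.prems B by (intro sum.cong prob_confined_step) auto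
  also have "\<dots> = surviving_mass B K a (Suc t) y" by (simp add: Suc.IH)
  finally show ?case .
qed

lemma prob_confined:
  assumes B: "B \<subseteq> S"
  shows "\<P>(\<omega> in M. \<forall>i\<le>t. X i \<omega> \<in> B) = (\<Sum>y\<in>B. surviving_mass B K a t y)"
proof -
  have "\<P>(\<omega> in M. \<forall>i\<le>t. X i \<omega> \<in> B) = (\<Sum>y\<in>B. \<P>(\<omega> in M. (\<forall>i\<le>t. X i \<omega> \<in> B) \<and> X t \<omega> = y))"
  proof (rule prob_sum)
    show "finite B" using finite_subset[OF B finite] .
    show "{\<omega>\<in>space M. (\<forall>i\<le>t. X i \<omega> \<in> B) \<and> X t \<omega> = y} \<in> events" for y
      by (rule confined_event)
    show "{\<omega>\<in>space M. \<forall>i\<le>t. X i \<omega> \<in> B} \<in> events"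
      by (rule chain_event_path[of t "\<lambda>_ s. s \<in> B"])
  qed (auto intro!: AE_I2)
  then show ?thesis by (simp add: prob_confined_at[OF B])
qed

lemma prob_hitting_time_gt:
  "\<P>(\<omega> in M. hitting_time X x \<omega> > enat t) = (\<Sum>y\<in>S - {x}. surviving_mass (S - {x}) K a t y)"
proof -
  have "\<P>(\<omega> in M. hitting_time X x \<omega> > enat t) = \<P>(\<omega> in M. \<forall>i\<le>t. X i \<omega> \<in> S - {x})"
    unfolding hitting_time_gt_iff using chain_in_state_space
    by (intro arg_cong[of _ _ "measure M"]) auto
  also have "\<dots> = (\<Sum>y\<in>S - {x}. surviving_mass (S - {x}) K a t y)"
    by (rule prob_confined) (rule Diff_subset)
  finally show ?thesis .
qed

end

section \<open>First visit times of rapidly mixing chains\<close>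

theorem theorem2p1:
  fixes S :: "nat \<Rightarrow> 'a set"
    and P :: "nat \<Rightarrow> 'a \<Rightarrow> 'a \<Rightarrow> real"
    and \<pi> :: "nat \<Rightarrow> 'a \<Rightarrow> real"
    and M :: "nat \<Rightarrow> 'w measure"
    and X :: "nat \<Rightarrow> nat \<Rightarrow> 'w \<Rightarrow> 'a"
    and c :: real
    and T :: "nat \<Rightarrow> nat"
    and x :: "nat \<Rightarrow> 'a"
  assumes "\<And>n. n \<ge> 1 \<Longrightarrow> finite (S n) \<and> card (S n) = n"
    and "\<And>n. n \<ge> 1 \<Longrightarrow> ergodic_kernel (S n) (P n)"
    and "\<And>n. n \<ge> 1 \<Longrightarrow> stationary_distribution (S n) (P n) (\<pi> n)"
    and "\<And>n y. n \<ge> 1 \<Longrightarrow> y \<in> S n \<Longrightarrow> irreducible_kernel (S n - {y}) (P n)"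
    and "\<And>n. n \<ge> 1 \<Longrightarrow> markov_chain (M n) (S n) (\<pi> n) (P n) (X n)"
    and "c > 2"
    and "\<And>n. T n > 0"
    and "filterlim T at_top sequentially"
    and HP1: "(\<lambda>n. Max ((\<lambda>(y, z). \<bar>kernel_power (S n) (P n) (T n) y z - \<pi> n z\<bar>) ` (S n \<times> S n)))
                \<in> o(\<lambda>n. real n powr (- c))"
    and HP2: "(\<lambda>n. real (T n) * Max (\<pi> n ` S n)) \<in> o(\<lambda>n. 1)"
    and HP3: "(\<lambda>n. Min (\<pi> n ` S n)) \<in> \<omega>(\<lambda>n. real n powr (- 2))"
    and "\<And>n. n \<ge> 1 \<Longrightarrow> x n \<in> S n"
  shows "((\<lambda>n. SUP t. ereal \<bar>\<P>(\<omega> in M n. hitting_time (X n) (x n) \<omega> > enat t)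
                              / leading_eigenvalue (S n - {x n}) (P n) ^ t - 1\<bar>) \<longlonglongrightarrow> 0) \<and>
         ((\<lambda>n. \<bar>leading_eigenvalue (S n - {x n}) (P n)
                  / (1 - \<pi> n (x n) / expected_returns (S n) (P n) (T n) (x n)) - 1\<bar>) \<longlonglongrightarrow> 0)"
proof -
  define d where "d n = Max ((\<lambda>(y, z). \<bar>kernel_power (S n) (P n) (T n) y z - \<pi> n z\<bar>) ` (S n \<times> S n))
      / Min (\<pi> n ` S n)" for n
  define e where "e n = 2 * ((1 + d n) * (real (T n) * \<pi> n (x n)))" for n
  define D where "D n = 1 - d n - e n * (1 + d n) / (1 - e n)" for n
  define l where "l n = leading_eigenvalue (S n - {x n}) (P n)" for n
  define R where "R n = expected_returns (S n) (P n) (T n) (x n)" for n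

  have pi_nonneg: "0 \<le> \<pi> n y" if "n \<ge> 1" "y \<in> S n" for n y
    using assms(3)[OF that(1)] that(2) unfolding stationary_distribution_def by blast
  have Min_nonneg: "0 \<le> Min (\<pi> n ` S n)" if "n \<ge> 1" for n
  proof -
    have "finite (\<pi> n ` S n)" "\<pi> n ` S n \<noteq> {}" using assms(1)[OF that] assms(12)[OF that] by blast+
    then have "Min (\<pi> n ` S n) \<in> \<pi> n ` S n" by (rule Min_in)
    then show ?thesis using pi_nonneg[OF that] by auto
  qed
  have large: "\<forall>\<^sub>F n in sequentially. 1 \<le> n" by (rule eventually_ge_at_top)
  have Min_ge: "\<forall>\<^sub>F n in sequentially. real n powr (- 2) \<le> Min (\<pi> n ` S n)"
    using landau_omega.smallD[OF HP3 zero_less_one] large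
  proof eventually_elim
    case (elim n)
    then show ?case using Min_nonneg[OF elim(2)] by simp
  qed
  have le_Max: "\<bar>kernel_power (S n) (P n) (T n) y z - \<pi> n z\<bar>
      \<le> Max ((\<lambda>(y, z). \<bar>kernel_power (S n) (P n) (T n) y z - \<pi> n z\<bar>) ` (S n \<times> S n))"
    if "n \<ge> 1" "y \<in> S n" "z \<in> S n" for n y z
  proof (rule Max_ge)
    show "finite ((\<lambda>(y, z). \<bar>kernel_power (S n) (P n) (T n) y z - \<pi> n z\<bar>) ` (S n \<times> S n))"
      using assms(1)[OF that(1)] by blast
    show "\<bar>kernel_power (S n) (P n) (T n) y z - \<pi> n z\<bar>
        \<in> (\<lambda>(y, z). \<bar>kernel_power (S n) (P n) (T n) y z - \<pi> n z\<bar>) ` (S n \<times> S n)"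
      by (rule image_eqI[of _ _ "(y, z)"]) (simp_all add: that)
  qed
  have d_nonneg: "0 \<le> d n" if "n \<ge> 1" for n
    using le_Max[OF that assms(12)[OF that] assms(12)[OF that]] Min_nonneg[OF that]
    unfolding d_def by (intro divide_nonneg_nonneg) auto
  have mixing: "\<bar>kernel_power (S n) (P n) (T n) y z - \<pi> n z\<bar> \<le> d n * \<pi> n z"
    if n: "n \<ge> 1" "real n powr (- 2) \<le> Min (\<pi> n ` S n)" and yz: "y \<in> S n" "z \<in> S n" for n y z
  proof -
    have "0 < real n powr (- 2)" using n by simp
    then have "0 < Min (\<pi> n ` S n)" using n by linarith
    then have "\<bar>kernel_power (S n) (P n) (T n) y z - \<pi> n z\<bar> \<le> d n * Min (\<pi> n ` S n)"
      using le_Max[OF n(1) yz] by (simp add: d_def)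
    also have "\<dots> \<le> d n * \<pi> n z"
      using assms(1)[OF n(1)] d_nonneg[OF n(1)] yz by (intro mult_left_mono Min_le) auto
    finally show ?thesis .
  qed

  have d_lim: "d \<longlonglongrightarrow> 0"
  proof (rule LIMSEQ_I)
    fix r :: real assume r: "0 < r"
    have "\<forall>\<^sub>F n in sequentially. norm (d n) < r"
      using landau_o.smallD[OF HP1 half_gt_zero[OF r]] Min_ge large
    proof (eventually_elim)
      case (elim n)
      have n: "1 \<le> real n" using elim by simp
      then have pos: "0 < real n powr (- 2)" by simp
      have "Max ((\<lambda>(y, z). \<bar>kernel_power (S n) (P n) (T n) y z - \<pi> n z\<bar>) ` (S n \<times> S n))
          \<le> r / 2 * real n powr (- c)" using elim r by simp
      \<comment> \<open>\<open>c \<ge> 2\<close> makes the mixing error negligible against \<open>min \<pi>\<close>, which eventually exceeds \<open>n\<^sup>-\<^sup>2\<close>.\<close>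
      also have "\<dots> \<le> r / 2 * real n powr (- 2)"
        using r n assms(6) by (intro mult_left_mono powr_mono) auto
      also have "\<dots> \<le> r / 2 * Min (\<pi> n ` S n)" using elim r by (intro mult_left_mono) auto
      finally have "d n \<le> r / 2"
        unfolding d_def using less_le_trans[OF pos] elim by (subst pos_divide_le_eq) auto
      then show ?case using d_nonneg elim r by simp
    qed
    then show "\<exists>N. \<forall>n\<ge>N. norm (d n - 0) < r" by (simp add: eventually_sequentially)
  qed

  have Tpi_le: "\<forall>\<^sub>F n in sequentially. real (T n) * \<pi> n (x n) \<le> real (T n) * Max (\<pi> n ` S n)"
    using large
  proof eventually_elim
    case (elim n)
    then show ?case using assms(1)[OF elim] assms(12)[OF elim] by (intro mult_left_mono Max_ge) simp_all
  qed
  have Tpi_lim: "(\<lambda>n. real (T n) * \<pi> n (x n)) \<longlonglongrightarrow> 0"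
  proof (rule tendsto_sandwich[OF _ Tpi_le tendsto_const])
    show "(\<lambda>n. real (T n) * Max (\<pi> n ` S n)) \<longlonglongrightarrow> 0"
      using HP2 by (auto dest: smalloD_tendsto)
    show "\<forall>\<^sub>F n in sequentially. 0 \<le> real (T n) * \<pi> n (x n)"
      using large
    proof eventually_elim
      case (elim n)
      show ?case using pi_nonneg[OF elim assms(12)[OF elim]] by simp
    qed
  qed
  have e_lim: "e \<longlonglongrightarrow> 0"
    unfolding e_def by (rule tendsto_eq_intros d_lim Tpi_lim refl | simp)+
  have D_lim: "D \<longlonglongrightarrow> 1"
    unfolding D_def by (rule tendsto_eq_intros d_lim e_lim refl | simp)+

  have D_pos: "\<forall>\<^sub>F n in sequentially. 0 < D n" by (rule order_tendstoD(1)[OF D_lim]) simp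
  have e_small: "\<forall>\<^sub>F n in sequentially. e n < 1 / 2" by (rule order_tendstoD(2)[OF e_lim]) simp
  have chains: "\<forall>\<^sub>F n in sequentially. n \<ge> 1 \<and> 0 < D n
      \<and> mixing_chain (S n) (P n) (\<pi> n) (x n) (T n) (d n)
      \<and> irreducible_kernel (S n - {x n}) (P n)"
    using large Min_ge D_pos e_small
  proof eventually_elim
    case (elim n)
    interpret stationary_chain "S n" "P n" "\<pi> n" "x n"
      using assms(1,2,3,12)[of n] elim by unfold_locales (auto simp: ergodic_kernel_def)
    have "mixing_chain (S n) (P n) (\<pi> n) (x n) (T n) (d n)"
      using elim assms(7)[of n] mixing[of n] d_nonneg[of n] by unfold_locales (auto simp: e_def)
    then show ?case using elim assms(4,12) by auto
  qed

  have "(\<lambda>n. SUP t. ereal \<bar>\<P>(\<omega> in M n. hitting_time (X n) (x n) \<omega> > enat t) / l n ^ t - 1\<bar>) \<longlonglongrightarrow> 0"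
  proof (rule tendsto_sandwich[OF always_eventually _ tendsto_const])
    show "\<forall>n. 0 \<le> (SUP t. ereal \<bar>\<P>(\<omega> in M n. hitting_time (X n) (x n) \<omega> > enat t) / l n ^ t - 1\<bar>)"
      by (auto intro: SUP_upper2)
    show "\<forall>\<^sub>F n in sequentially. (SUP t. ereal \<bar>\<P>(\<omega> in M n. hitting_time (X n) (x n) \<omega> > enat t) / l n ^ t - 1\<bar>)
        \<le> ereal ((d n + e n) + \<bar>1 / D n - 1\<bar>)"
      using chains
    proof eventually_elim
      case (elim n)
      interpret mixing_chain "S n" "P n" "\<pi> n" "x n" "T n" "d n" using elim by blast
      have "\<P>(\<omega> in M n. hitting_time (X n) (x n) \<omega> > enat t) = survival t" for t
        unfolding survival_def using elim assms(1,5) by (intro prob_hitting_time_gt) auto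
      moreover have "loss = e n" by (simp add: e_def loss_def)
      ultimately show ?case
        using survival_ratio_error elim by (intro SUP_least) (simp add: l_def D_def)
    qed
    have "(\<lambda>n. (d n + e n) + \<bar>1 / D n - 1\<bar>) \<longlonglongrightarrow> 0"
      by (rule tendsto_eq_intros d_lim e_lim D_lim refl | simp)+
    then show "(\<lambda>n. ereal ((d n + e n) + \<bar>1 / D n - 1\<bar>)) \<longlonglongrightarrow> 0"
      unfolding zero_ereal_def by simp
  qed
  moreover have "(\<lambda>n. \<bar>l n / (1 - \<pi> n (x n) / R n) - 1\<bar>) \<longlonglongrightarrow> 0"
  proof -
    have l_bounds: "\<forall>\<^sub>F n in sequentially. 1 - e n \<le> l n \<and> l n \<le> 1"
      using chains
    proof eventually_elim
      case (elim n)
      interpret mixing_chain "S n" "P n" "\<pi> n" "x n" "T n" "d n" using elim by blast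
      have "loss = e n" by (simp add: e_def loss_def)
      then show ?case using leading_eigenvalue_bounds(1,2) elim by (simp add: l_def)
    qed
    have l_lim: "l \<longlonglongrightarrow> 1"
    proof (rule tendsto_sandwich[OF _ _ _ tendsto_const])
      show "(\<lambda>n. 1 - e n) \<longlonglongrightarrow> 1" by (rule tendsto_eq_intros e_lim refl | simp)+
      show "\<forall>\<^sub>F n in sequentially. 1 - e n \<le> l n" "\<forall>\<^sub>F n in sequentially. l n \<le> 1"
        using l_bounds by (rule eventually_mono, simp)+
    qed
    have R: "1 \<le> R n" if n: "n \<ge> 1" for n
    proof -
      have "kernel_power (S n) (P n) 0 (x n) (x n) \<le> R n"
        unfolding R_def expected_returns_def using assms(2,12)[OF n]
        by (intro member_le_sum kernel_power_nonneg) (auto simp: ergodic_kernel_def stochastic_kernel_def)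
      then show ?thesis by simp
    qed
    have "0 \<le> \<pi> n (x n) / R n \<and> \<pi> n (x n) / R n \<le> real (T n) * \<pi> n (x n)" if n: "n \<ge> 1" for n
    proof -
      have pi0: "0 \<le> \<pi> n (x n)" using pi_nonneg assms(12) n by blast
      have "\<pi> n (x n) / R n \<le> \<pi> n (x n) / 1"
        using pi0 R[OF n] by (intro divide_left_mono) auto
      also have "\<dots> \<le> real (T n) * \<pi> n (x n)"
        using mult_right_mono[of 1 "real (T n)" "\<pi> n (x n)"] pi0 assms(7)[of n] by simp
      finally show ?thesis using pi0 R[OF n] by simp
    qed
    then have pi_R_ge: "\<forall>\<^sub>F n in sequentially. 0 \<le> \<pi> n (x n) / R n"
      and pi_R_le: "\<forall>\<^sub>F n in sequentially. \<pi> n (x n) / R n \<le> real (T n) * \<pi> n (x n)"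
      unfolding eventually_sequentially by blast+
    have pi_R: "(\<lambda>n. \<pi> n (x n) / R n) \<longlonglongrightarrow> 0"
      by (rule tendsto_sandwich[OF pi_R_ge pi_R_le tendsto_const Tpi_lim])
    show ?thesis by (rule tendsto_eq_intros l_lim pi_R refl | simp)+
  qed
  ultimately show ?thesis unfolding l_def R_def by blast
qed

end
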